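(* Let $q>2$ be a prime power, $n\ge 3$, and let $(\Omega,\{R_0,\dots,R_4\})$ be the association scheme on the points of $\mathsf{Q}^-(2n-1,q)$ outside a nondegenerate hyperplane, with simultaneous eigenspaces $V_0,\dots,V_4$ ordered as in the context. Let $\theta\subseteq\Omega$ be nontrivial ($\emptyset\ne\theta\ne\Omega$). If $\chi_\theta\in V_0\perp V_1$ (intriguing set of type 1), or $\chi_\theta\in V_0\perp V_3$ (intriguing set of type 3), or $\chi_\theta\in V_0\perp V_1\perp V_3$ (a $\{2,4\}$-design), then $|\theta|=\tfrac12|\Omega|$. Moreover, if $n=3$ and $\chi_\theta\in V_0\perp V_1\perp V_4$ (a $\{2,3\}$-design), then either $\chi_\theta\in V_0\perp V_4$ (i.e. $\theta$ is a $\{1,2,3\}$-design) or $|\theta|=\tfrac12|\Omega|$.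
   Context: Let $\Omega$ be the set of points of $\mathsf{Q}^-(2n-1,q)$ not in a fixed hyperplane $\Pi$ with nondegenerate section. With $\perp$ the polarity of the quadric, for $P\in\Omega$ the line through $P$ and the pole $\Pi^\perp$ meets the quadric in exactly two points, and $P^\sigma$ denotes the one other than $P$. Write $X\sim Y$ if $X\ne Y$ and $X,Y$ are collinear on the quadric. Relations: $R_0$ identity; $R_1=\{(X,Y):Y\not\sim X,\ X\sim Y^\sigma\}$; $R_2=\{(X,Y):Y\not\sim X,\ X\not\sim Y^\sigma\}$; $R_3=\{(X,Y):Y\sim X,\ X\not\sim Y^\sigma\}$; $R_4=\{(X,Y):X=Y^\sigma\}$. This is an association scheme whose minimal idempotents $E_0=\frac1{|\Omega|}J,E_1,\dots,E_4$ are ordered so that the eigenvalue of the adjacency matrix of $R_\ell$ on $V_i$ (the column space of $E_i$) is the $(i,\ell)$ entry of \[ \begin{bmatrix} 1 & ( q^{n-2}-1)(q^{n-1}+1) & q^{n-2} ( q-2) (q^{n-1}+1) & ( q^{n-2}-1)(q^{n-1}+1) & 1\\ 1 & {q}^{n-1}+1 & 0 & -( {q}^{n-1}+1) & -1\\ 1 & q^{n-2}-1 & -2q^{n-2} & q^{n-2}-1 & 1\\ 1 & -( q^{n-2}-1) & 0 & q^{n-2}-1 & -1\\ 1 &-q^{n - 2}(q - 2)-1& 2q^{n-2}( q-2) & -q^{n - 2}(q - 2)-1& 1 \end{bmatrix}. \] For $T\subseteq\{1,\dots,4\}$, a (Delsarte) $T$-design is a subset $\theta$ with $\chi_\theta E_i=0$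 for all $i\in T$; $\chi_\theta$ is the characteristic vector.
   Formalization: The relation R_2 is taken to exclude the pairs with X=Y and X=Y^σ; as printed it would contain R_0 and R_4, so the relations would not partition Ω×Ω or have the stated valencies. *)

theory Defs
  imports "HOL-Analysis.Cartesian_Space" "HOL-Library.Indicator_Function"
begin

section \<open>Quadratic forms on a coordinate space\<close>

definition polar_form :: "('a::field ^ 'd \<Rightarrow> 'a) \<Rightarrow> 'a ^ 'd \<Rightarrow> 'a ^ 'd \<Rightarrow> 'a"
  where "polar_form Q u v = Q (u + v) - Q u - Q v"

text \<open>The polar form is symmetric, so linearity in one argument gives bilinearity. No
  assumption is made on the characteristic.\<close>

definition quadratic_form :: "('a::field ^ 'd \<Rightarrow> 'a) \<Rightarrow> bool"
  where "quadratic_form Q \<longleftrightarrow>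
    (\<forall>c v. Q (c *s v) = c\<^sup>2 * Q v) \<and>
    (\<forall>u. Vector_Spaces.linear (*s) (*) (polar_form Q u))"

text \<open>The quadric section by the projective space of \<open>W\<close> has no singular point. In
  characteristic 2 the polar form may have a nonzero radical on \<open>W\<close> (the nucleus of a
  parabolic quadric).\<close>

definition nondegenerate_on :: "('a::field ^ 'd \<Rightarrow> 'a) \<Rightarrow> ('a ^ 'd) set \<Rightarrow> bool"
  where "nondegenerate_on Q W \<longleftrightarrow>
    (\<forall>v\<in>W. Q v = 0 \<and> (\<forall>w\<in>W. polar_form Q v w = 0) \<longrightarrow> v = 0)"

definition totally_singular :: "('a::field ^ 'd \<Rightarrow> 'a) \<Rightarrow> ('a ^ 'd) set \<Rightarrow> bool"
  where "totally_singular Q W \<longleftrightarrow> vec.subspace W \<and> (\<forall>v\<in>W. Q v = 0)"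

definition witt_index :: "('a::field ^ 'd \<Rightarrow> 'a) \<Rightarrow> nat"
  where "witt_index Q = Max {vec.dim W | W. totally_singular Q W}"

text \<open>The forms defining an elliptic quadric \<open>Q\<^sup>-(2n-1,q)\<close>: vector space dimension \<open>2n\<close>,
  Witt index \<open>n - 1\<close>.\<close>

definition elliptic_form :: "('a::field ^ 'd \<Rightarrow> 'a) \<Rightarrow> bool"
  where "elliptic_form Q \<longleftrightarrow>
    quadratic_form Q \<and> nondegenerate_on Q UNIV \<and> CARD('d) = 2 * (witt_index Q + 1)"


section \<open>Points of the quadric outside a hyperplane\<close>

text \<open>Projective points are one-dimensional subspaces, hyperplanes are subspaces of
  codimension one.\<close>

definition quadric_points :: "('a::field ^ 'd \<Rightarrow> 'a) \<Rightarrow> ('a ^ 'd) set set"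
  where "quadric_points Q = {vec.span {v} | v. v \<noteq> 0 \<and> Q v = 0}"

definition hyperplane :: "('a::field ^ 'd) set \<Rightarrow> bool"
  where "hyperplane H \<longleftrightarrow> vec.subspace H \<and> vec.dim H + 1 = CARD('d)"

definition perp :: "('a::field ^ 'd \<Rightarrow> 'a) \<Rightarrow> ('a ^ 'd) set \<Rightarrow> ('a ^ 'd) set"
  where "perp Q S = {w. \<forall>v\<in>S. polar_form Q v w = 0}"

definition Omega :: "('a::field ^ 'd \<Rightarrow> 'a) \<Rightarrow> ('a ^ 'd) set \<Rightarrow> ('a ^ 'd) set set"
  where "Omega Q H = {P \<in> quadric_points Q. \<not> P \<subseteq> H}"

definition sigma ::
    "('a::field ^ 'd \<Rightarrow> 'a) \<Rightarrow> ('a ^ 'd) set \<Rightarrow> ('a ^ 'd) set \<Rightarrow> ('a ^ 'd) set"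
  where "sigma Q H P =
    (THE P'. P' \<in> quadric_points Q \<and> P' \<noteq> P \<and> P' \<subseteq> vec.span (P \<union> perp Q H))"

definition collinear_on ::
    "('a::field ^ 'd \<Rightarrow> 'a) \<Rightarrow> ('a ^ 'd) set \<Rightarrow> ('a ^ 'd) set \<Rightarrow> bool"
  where "collinear_on Q X Y \<longleftrightarrow> X \<noteq> Y \<and> (\<forall>v\<in>vec.span (X \<union> Y). Q v = 0)"

text \<open>Since a point is collinear neither with itself nor with its image under \<open>sigma\<close>, the
  relation with index 2 has to exclude the pairs of the relations 0 and 4 explicitly.\<close>

definition scheme_rel :: "('a::field ^ 'd \<Rightarrow> 'a) \<Rightarrow> ('a ^ 'd) set \<Rightarrow> nat \<Rightarrow>
    (('a ^ 'd) set \<times> ('a ^ 'd) set) set"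
  where "scheme_rel Q H l = {(X, Y) \<in> Omega Q H \<times> Omega Q H.
    [X = Y,
     \<not> collinear_on Q Y X \<and> collinear_on Q X (sigma Q H Y),
     X \<noteq> Y \<and> X \<noteq> sigma Q H Y \<and> \<not> collinear_on Q Y X \<and> \<not> collinear_on Q X (sigma Q H Y),
     collinear_on Q Y X \<and> \<not> collinear_on Q X (sigma Q H Y),
     X = sigma Q H Y] ! l}"


section \<open>Bose--Mesner algebra, minimal idempotents and eigenspaces\<close>

text \<open>Real vectors and matrices indexed by a finite set \<open>S\<close> are functions that vanish outside
  \<open>S\<close>; all operations sum over \<open>S\<close>.\<close>

definition mat_mul ::
    "'x set \<Rightarrow> ('x \<Rightarrow> 'x \<Rightarrow> real) \<Rightarrow> ('x \<Rightarrow> 'x \<Rightarrow> real) \<Rightarrow> 'x \<Rightarrow> 'x \<Rightarrow> real"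
  where "mat_mul S A B = (\<lambda>x y. \<Sum>z\<in>S. A x z * B z y)"

definition mat_vec :: "'x set \<Rightarrow> ('x \<Rightarrow> 'x \<Rightarrow> real) \<Rightarrow> ('x \<Rightarrow> real) \<Rightarrow> 'x \<Rightarrow> real"
  where "mat_vec S A v = (\<lambda>x. \<Sum>y\<in>S. A x y * v y)"

definition adjacency :: "('x \<times> 'x) set \<Rightarrow> 'x \<Rightarrow> 'x \<Rightarrow> real"
  where "adjacency r = (\<lambda>x y. of_bool ((x, y) \<in> r))"

definition bose_mesner :: "nat \<Rightarrow> (nat \<Rightarrow> ('x \<times> 'x) set) \<Rightarrow> ('x \<Rightarrow> 'x \<Rightarrow> real) set"
  where "bose_mesner d R = {(\<lambda>x y. \<Sum>l\<le>d. c l * adjacency (R l) x y) | c. True}"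

definition minimal_idempotents ::
    "'x set \<Rightarrow> ('x \<Rightarrow> 'x \<Rightarrow> real) set \<Rightarrow> ('x \<Rightarrow> 'x \<Rightarrow> real) set"
  where "minimal_idempotents S \<A> = {E \<in> \<A>. E \<noteq> (\<lambda>x y. 0) \<and> mat_mul S E E = E \<and>
    (\<forall>F\<in>\<A>. mat_mul S F F = F \<and> mat_mul S E F = F \<and> mat_mul S F E = F
       \<longrightarrow> F = (\<lambda>x y. 0) \<or> F = E)}"

definition column_space :: "'x set \<Rightarrow> ('x \<Rightarrow> 'x \<Rightarrow> real) \<Rightarrow> ('x \<Rightarrow> real) set"
  where "column_space S A = range (mat_vec S A)"

text \<open>The sum of the column spaces of \<open>E i\<close>, \<open>i \<in> I\<close>. For minimal idempotents of a
  symmetric association scheme this sum is automatically direct and orthogonal.\<close>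

definition eigenspace_sum ::
    "'x set \<Rightarrow> (nat \<Rightarrow> 'x \<Rightarrow> 'x \<Rightarrow> real) \<Rightarrow> nat set \<Rightarrow> ('x \<Rightarrow> real) set"
  where "eigenspace_sum S E I =
    {(\<lambda>x. \<Sum>i\<in>I. v i x) | v. \<forall>i\<in>I. v i \<in> column_space S (E i)}"

definition eigenmatrix :: "real \<Rightarrow> nat \<Rightarrow> nat \<Rightarrow> nat \<Rightarrow> real"
  where "eigenmatrix q n i l =
   [[1, (q^(n-2) - 1) * (q^(n-1) + 1), q^(n-2) * (q - 2) * (q^(n-1) + 1),
        (q^(n-2) - 1) * (q^(n-1) + 1), 1],
    [1, q^(n-1) + 1, 0, - (q^(n-1) + 1), -1],
    [1, q^(n-2) - 1, - 2 * q^(n-2), q^(n-2) - 1, 1],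
    [1, - (q^(n-2) - 1), 0, q^(n-2) - 1, -1],
    [1, - (q^(n-2)) * (q - 2) - 1, 2 * q^(n-2) * (q - 2), - (q^(n-2)) * (q - 2) - 1, 1]] ! i ! l"

text \<open>\<open>E 0, \<dots>, E 4\<close> enumerate the minimal idempotents of the scheme in the order prescribed
  by the rows of the eigenmatrix, for the ground field of order \<open>q = CARD('a)\<close> and vector
  space dimension \<open>2 * n\<close>.\<close>

definition ordered_idempotents :: "('a::{field,finite} ^ 'd \<Rightarrow> 'a) \<Rightarrow> ('a ^ 'd) set \<Rightarrow> nat \<Rightarrow>
    (nat \<Rightarrow> ('a ^ 'd) set \<Rightarrow> ('a ^ 'd) set \<Rightarrow> real) \<Rightarrow> bool"
  where "ordered_idempotents Q H n E \<longleftrightarrow>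
    bij_betw E {..4} (minimal_idempotents (Omega Q H) (bose_mesner 4 (scheme_rel Q H))) \<and>
    E 0 = (\<lambda>X Y. of_bool (X \<in> Omega Q H \<and> Y \<in> Omega Q H) / real (card (Omega Q H))) \<and>
    (\<forall>i\<le>4. \<forall>l\<le>4. \<forall>v\<in>column_space (Omega Q H) (E i).
       mat_vec (Omega Q H) (adjacency (scheme_rel Q H l)) v =
         (\<lambda>X. eigenmatrix (real CARD('a)) n i l * v X))"

end

theory Submission imports Defs begin

text \<open>The relation \<open>R\<^sub>4\<close> is a fixed-point-free involution whose matrix has eigenvalue \<open>1\<close> on
  \<open>V\<^sub>0, V\<^sub>2, V\<^sub>4\<close> and \<open>-1\<close> on \<open>V\<^sub>1, V\<^sub>3\<close>. If the characteristic vector is \<open>c + w\<close> with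
  \<open>w\<close> in the \<open>-1\<close> eigenspace, then its symmetrisation is the constant \<open>2c\<close> and takes values in
  \<open>{0, 1, 2}\<close>, so \<open>c = 1/2\<close>. If it is \<open>c + v\<^sub>1 + v\<^sub>4\<close>, then wherever \<open>v\<^sub>1\<close> is nonzero exactly
  one point of the pair lies in the set, so \<open>2c + 2v\<^sub>4 = 1\<close> there, which gives
  \<open>v\<^sub>1\<^sup>2 v\<^sub>4 = (1/2 - c) v\<^sub>1\<^sup>2\<close> everywhere. For \<open>n = 3\<close> the Krein parameter \<open>q\<^sub>1\<^sub>1\<^sup>4\<close> vanishes, so
  the left-hand side sums to zero, whence \<open>v\<^sub>1 = 0\<close> or \<open>c = 1/2\<close>.

  The symmetry of the relations and the fact that they partition \<open>\<Omega> \<times> \<Omega>\<close> are read off the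
  eigenmatrix instead of the geometry of the quadric: since it is nonsingular, every relation matrix
  is the combination of the idempotents given by its column.\<close>

section \<open>Matrices indexed by a finite set\<close>

lemma mat_mul_assoc: "mat_mul S (mat_mul S A B) C = mat_mul S A (mat_mul S B C)"
proof (intro ext)
  fix x y
  have "mat_mul S (mat_mul S A B) C x y = (\<Sum>z\<in>S. \<Sum>w\<in>S. A x w * B w z * C z y)"
    by (simp add: mat_mul_def sum_distrib_right)
  also have "\<dots> = (\<Sum>w\<in>S. \<Sum>z\<in>S. A x w * B w z * C z y)"
    by (rule sum.swap)
  also have "\<dots> = mat_mul S A (mat_mul S B C) x y"
    by (simp add: mat_mul_def sum_distrib_left mult.assoc)
  finally show "mat_mul S (mat_mul S A B) C x y = mat_mul S A (mat_mul S B C) x y" .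
qed

lemma mat_vec_mat_mul: "mat_vec S (mat_mul S A B) v = mat_vec S A (mat_vec S B v)"
proof
  fix x
  have "mat_vec S (mat_mul S A B) v x = (\<Sum>z\<in>S. \<Sum>w\<in>S. A x w * B w z * v z)"
    by (simp add: mat_vec_def mat_mul_def sum_distrib_right)
  also have "\<dots> = (\<Sum>w\<in>S. \<Sum>z\<in>S. A x w * B w z * v z)"
    by (rule sum.swap)
  also have "\<dots> = mat_vec S A (mat_vec S B v) x"
    by (simp add: mat_vec_def sum_distrib_left mult.assoc)
  finally show "mat_vec S (mat_mul S A B) v x = mat_vec S A (mat_vec S B v) x" .
qed

lemma mat_mul_sum_left:
  "mat_mul S (\<lambda>x y. \<Sum>i\<in>I. c i * A i x y) B = (\<lambda>x y. \<Sum>i\<in>I. c i * mat_mul S (A i) B x y)"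
proof (intro ext)
  fix x y
  have "mat_mul S (\<lambda>x y. \<Sum>i\<in>I. c i * A i x y) B x y = (\<Sum>z\<in>S. \<Sum>i\<in>I. c i * A i x z * B z y)"
    by (simp add: mat_mul_def sum_distrib_right)
  also have "\<dots> = (\<Sum>i\<in>I. \<Sum>z\<in>S. c i * A i x z * B z y)"
    by (rule sum.swap)
  finally show "mat_mul S (\<lambda>x y. \<Sum>i\<in>I. c i * A i x y) B x y
      = (\<Sum>i\<in>I. c i * mat_mul S (A i) B x y)"
    by (simp add: mat_mul_def sum_distrib_left mult.assoc)
qed

lemma mat_mul_sum_right:
  "mat_mul S B (\<lambda>x y. \<Sum>i\<in>I. c i * A i x y) = (\<lambda>x y. \<Sum>i\<in>I. c i * mat_mul S B (A i) x y)"
proof (intro ext)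
  fix x y
  have "mat_mul S B (\<lambda>x y. \<Sum>i\<in>I. c i * A i x y) x y = (\<Sum>z\<in>S. \<Sum>i\<in>I. c i * (B x z * A i z y))"
    by (simp add: mat_mul_def sum_distrib_left mult.left_commute)
  also have "\<dots> = (\<Sum>i\<in>I. \<Sum>z\<in>S. c i * (B x z * A i z y))"
    by (rule sum.swap)
  finally show "mat_mul S B (\<lambda>x y. \<Sum>i\<in>I. c i * A i x y) x y
      = (\<Sum>i\<in>I. c i * mat_mul S B (A i) x y)"
    by (simp add: mat_mul_def sum_distrib_left)
qed

lemma mat_mul_scale_right: "mat_mul S A (\<lambda>x y. c * B x y) = (\<lambda>x y. c * mat_mul S A B x y)"
  by (simp add: mat_mul_def sum_distrib_left mult.left_commute)

lemma mat_mul_scale_left: "mat_mul S (\<lambda>x y. c * A x y) B = (\<lambda>x y. c * mat_mul S A B x y)"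
  by (simp add: mat_mul_def sum_distrib_left mult.assoc)

lemma column_in_column_space:
  assumes "finite S" "y \<in> S"
  shows "(\<lambda>x. A x y) \<in> column_space S A"
proof -
  have "mat_vec S A (\<lambda>z. of_bool (z = y)) = (\<lambda>x. A x y)"
    using assms by (simp add: mat_vec_def of_bool_def if_distrib cong: if_cong)
  then show ?thesis
    unfolding column_space_def by (metis rangeI)
qed

lemma zero_in_column_space: "(\<lambda>x. 0) \<in> column_space S A"
proof -
  have "mat_vec S A (\<lambda>x. 0) = (\<lambda>x. 0)"
    by (simp add: mat_vec_def)
  then show ?thesis
    unfolding column_space_def by (metis rangeI)
qed

text \<open>Missing components are padded with the zero vector, which lies in every column
  space.\<close>

lemma eigenspace_sum_mono:
  assumes "I \<subseteq> J" "finite J"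
  shows "eigenspace_sum S E I \<subseteq> eigenspace_sum S E J"
proof
  fix f assume "f \<in> eigenspace_sum S E I"
  then obtain v where v: "f = (\<lambda>x. \<Sum>i\<in>I. v i x)" "\<forall>i\<in>I. v i \<in> column_space S (E i)"
    unfolding eigenspace_sum_def by blast
  define w where "w i = (if i \<in> I then v i else (\<lambda>x. 0))" for i
  have "(\<Sum>i\<in>J. w i x) = (\<Sum>i\<in>I. v i x)" for x
    by (rule sum.mono_neutral_cong_right) (use assms in \<open>auto simp: w_def\<close>)
  then have "f = (\<lambda>x. \<Sum>i\<in>J. w i x)"
    using v by simp
  moreover have "\<forall>i\<in>J. w i \<in> column_space S (E i)"
    using v zero_in_column_space by (auto simp: w_def)
  ultimately show "f \<in> eigenspace_sum S E J"
    unfolding eigenspace_sum_def by blast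
qed

section \<open>Triple products and vanishing Krein parameters\<close>

lemma sum_rotate:
  "(\<Sum>x\<in>X. \<Sum>a\<in>A. \<Sum>b\<in>B. \<Sum>c\<in>C. f x a b c) = (\<Sum>a\<in>A. \<Sum>b\<in>B. \<Sum>c\<in>C. \<Sum>x\<in>X. f x a b c)"
proof -
  have "(\<Sum>x\<in>X. \<Sum>a\<in>A. \<Sum>b\<in>B. \<Sum>c\<in>C. f x a b c) = (\<Sum>a\<in>A. \<Sum>x\<in>X. \<Sum>b\<in>B. \<Sum>c\<in>C. f x a b c)"
    by (rule sum.swap)
  also have "\<dots> = (\<Sum>a\<in>A. \<Sum>b\<in>B. \<Sum>x\<in>X. \<Sum>c\<in>C. f x a b c)"
    by (intro sum.cong refl sum.swap)
  also have "\<dots> = (\<Sum>a\<in>A. \<Sum>b\<in>B. \<Sum>c\<in>C. \<Sum>x\<in>X. f x a b c)"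
    by (intro sum.cong refl sum.swap)
  finally show ?thesis .
qed

lemma sum_product_3:
  fixes f g h :: "'x \<Rightarrow> real"
  shows "sum f A * sum g B * sum h C = (\<Sum>a\<in>A. \<Sum>b\<in>B. \<Sum>c\<in>C. f a * g b * h c)"
proof -
  have "sum f A * sum g B * sum h C = sum f A * (sum g B * sum h C)"
    by (rule mult.assoc)
  also have "\<dots> = (\<Sum>a\<in>A. \<Sum>b\<in>B. \<Sum>c\<in>C. f a * (g b * h c))"
    by (simp only: sum_product[of g B h C] sum_distrib_right) (simp only: sum_distrib_left)
  finally show ?thesis
    by (simp only: mult.assoc)
qed

text \<open>Vanishing of a Krein parameter. The hypothesis says that \<open>E \<otimes> F \<otimes> G\<close>, a symmetric
  idempotent, has quadratic form zero at the diagonal tensor \<open>\<Sum>x. e\<^sub>x \<otimes> e\<^sub>x \<otimes> e\<^sub>x\<close>, hence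
  annihilates it.\<close>

lemma krein_vanishing:
  assumes fin: "finite S"
    and idem: "mat_mul S E E = E" "mat_mul S F F = F" "mat_mul S G G = G"
    and sym: "\<And>x y. E x y = E y x" "\<And>x y. F x y = F y x" "\<And>x y. G x y = G y x"
    and zero: "(\<Sum>x\<in>S. \<Sum>y\<in>S. E x y * F x y * G x y) = 0"
    and u: "u \<in> column_space S E" and v: "v \<in> column_space S F" and w: "w \<in> column_space S G"
  shows "(\<Sum>x\<in>S. u x * v x * w x) = 0"
proof -
  \<comment> \<open>\<open>T\<close> lists the coordinates of the image of the diagonal tensor under
    \<open>E \<otimes> F \<otimes> G\<close>, so the aim is \<open>T = 0\<close>.\<close>
  define T where "T a b c = (\<Sum>x\<in>S. E x a * F x b * G x c)" for a b c
  have gram: "(\<Sum>a\<in>S. A x a * A y a) = A x y" if "mat_mul S A A = A" "\<And>x y. A x y = A y x"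
    for A :: "'a \<Rightarrow> 'a \<Rightarrow> real" and x y
  proof -
    have "(\<Sum>a\<in>S. A x a * A y a) = (\<Sum>a\<in>S. A x a * A a y)"
      by (rule sum.cong) (use that(2) in auto)
    also have "\<dots> = mat_mul S A A x y"
      by (simp add: mat_mul_def)
    finally show ?thesis
      using that(1) by simp
  qed
  \<comment> \<open>The squared norm of \<open>T\<close> collapses to the sum in
    \<open>zero\<close>: since each matrix is a symmetric idempotent, the inner product of two of
    its rows is again an entry of it.\<close>
  have "(\<Sum>a\<in>S. \<Sum>b\<in>S. \<Sum>c\<in>S. (T a b c)\<^sup>2)
      = (\<Sum>a\<in>S. \<Sum>b\<in>S. \<Sum>c\<in>S. \<Sum>x\<in>S. E x a * F x b * G x c * T a b c)"
    by (simp add: T_def power2_eq_square sum_distrib_right)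
  also have "\<dots> = (\<Sum>x\<in>S. \<Sum>a\<in>S. \<Sum>b\<in>S. \<Sum>c\<in>S. E x a * F x b * G x c * T a b c)"
    by (rule sum_rotate[symmetric])
  also have "\<dots> = (\<Sum>x\<in>S. \<Sum>y\<in>S. E x y * F x y * G x y)"
  proof (rule sum.cong[OF refl])
    fix x
    have "(\<Sum>a\<in>S. \<Sum>b\<in>S. \<Sum>c\<in>S. E x a * F x b * G x c * T a b c)
        = (\<Sum>a\<in>S. \<Sum>b\<in>S. \<Sum>c\<in>S. \<Sum>y\<in>S. (E x a * E y a) * (F x b * F y b) * (G x c * G y c))"
      unfolding T_def sum_distrib_left by (intro sum.cong refl) simp
    also have "\<dots> = (\<Sum>y\<in>S. \<Sum>a\<in>S. \<Sum>b\<in>S. \<Sum>c\<in>S.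
        (E x a * E y a) * (F x b * F y b) * (G x c * G y c))"
      by (rule sum_rotate[symmetric])
    finally show "(\<Sum>a\<in>S. \<Sum>b\<in>S. \<Sum>c\<in>S. E x a * F x b * G x c * T a b c)
        = (\<Sum>y\<in>S. E x y * F x y * G x y)"
      by (simp only: sum_product_3[symmetric] gram[OF idem(1) sym(1)] gram[OF idem(2) sym(2)]
          gram[OF idem(3) sym(3)])
  qed
  finally have "(\<Sum>a\<in>S. \<Sum>b\<in>S. \<Sum>c\<in>S. (T a b c)\<^sup>2) = 0"
    using zero by simp
  then have T0: "T a b c = 0" if "a \<in> S" "b \<in> S" "c \<in> S" for a b c
    using that fin by (simp add: sum_nonneg_eq_0_iff sum_nonneg)
  obtain u' v' w' where "u = mat_vec S E u'" "v = mat_vec S F v'" "w = mat_vec S G w'"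
    using u v w unfolding column_space_def by blast
  \<comment> \<open>With preimages \<open>u'\<close>, \<open>v'\<close>, \<open>w'\<close> the sum
    becomes the pairing of their tensor product with \<open>T\<close>.\<close>
  then have "(\<Sum>x\<in>S. u x * v x * w x)
      = (\<Sum>x\<in>S. \<Sum>a\<in>S. \<Sum>b\<in>S. \<Sum>c\<in>S. (E x a * u' a) * (F x b * v' b) * (G x c * w' c))"
    by (simp only: mat_vec_def sum_product_3)
  also have "\<dots> = (\<Sum>a\<in>S. \<Sum>b\<in>S. \<Sum>c\<in>S. \<Sum>x\<in>S. (E x a * u' a) * (F x b * v' b) * (G x c * w' c))"
    by (rule sum_rotate)
  also have "\<dots> = (\<Sum>a\<in>S. \<Sum>b\<in>S. \<Sum>c\<in>S. (u' a * v' b * w' c) * T a b c)"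
    unfolding T_def sum_distrib_left by (intro sum.cong refl) simp
  also have "\<dots> = 0"
    by (simp add: T0)
  finally show ?thesis .
qed


section \<open>Idempotents with prescribed eigenvalues\<close>

text \<open>The assumptions are what the enumeration of idempotents delivers directly, together with
  two arithmetic properties of the eigenmatrix: \<open>rows_distinct\<close> separates the
  eigenspaces, and \<open>nonsingular\<close> recovers the relation matrices from the idempotents.
  Disjointness and symmetry of the relations are left to be deduced afterwards.\<close>

locale spectral_scheme =
  fixes S :: "'x set" and d :: nat and R :: "nat \<Rightarrow> ('x \<times> 'x) set"
    and P :: "nat \<Rightarrow> nat \<Rightarrow> real" and E :: "nat \<Rightarrow> 'x \<Rightarrow> 'x \<Rightarrow> real"
  assumes finite_S: "finite S"
    and rel_sub: "l \<le> d \<Longrightarrow> R l \<subseteq> S \<times> S"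
    and E_in: "i \<le> d \<Longrightarrow> E i \<in> bose_mesner d R"
    and E_nonzero: "i \<le> d \<Longrightarrow> E i \<noteq> (\<lambda>x y. 0)"
    and E_idem: "i \<le> d \<Longrightarrow> mat_mul S (E i) (E i) = E i"
    and eigen: "\<lbrakk>i \<le> d; l \<le> d; v \<in> column_space S (E i)\<rbrakk>
      \<Longrightarrow> mat_vec S (adjacency (R l)) v = (\<lambda>x. P i l * v x)"
    and rows_distinct: "\<lbrakk>i \<le> d; j \<le> d; i \<noteq> j\<rbrakk> \<Longrightarrow> \<exists>l\<le>d. P i l \<noteq> P j l"
    and nonsingular: "\<lbrakk>\<And>j. j \<le> d \<Longrightarrow> (\<Sum>m\<le>d. c m * P j m) = 0; m \<le> d\<rbrakk> \<Longrightarrow> c m = 0"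
begin

abbreviation "A l \<equiv> adjacency (R l)"

text \<open>Membership in \<open>bose_mesner\<close> only asserts that coordinates exist, so one
  choice is fixed.\<close>

definition coeff :: "nat \<Rightarrow> nat \<Rightarrow> real" where
  "coeff i = (SOME c. E i = (\<lambda>x y. \<Sum>l\<le>d. c l * A l x y))"

lemma E_expand: "i \<le> d \<Longrightarrow> E i = (\<lambda>x y. \<Sum>l\<le>d. coeff i l * A l x y)"
  using E_in[of i] unfolding coeff_def bose_mesner_def mem_Collect_eq simp_thms
  by (rule someI_ex)

lemma A_outside: "\<lbrakk>l \<le> d; x \<notin> S \<or> y \<notin> S\<rbrakk> \<Longrightarrow> A l x y = 0"
  using rel_sub by (auto simp: adjacency_def)

lemma E_outside: "\<lbrakk>i \<le> d; x \<notin> S \<or> y \<notin> S\<rbrakk> \<Longrightarrow> E i x y = 0"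
  by (subst E_expand) (auto simp: A_outside)

lemma column_space_outside: "\<lbrakk>i \<le> d; v \<in> column_space S (E i); x \<notin> S\<rbrakk> \<Longrightarrow> v x = 0"
  by (auto simp: column_space_def mat_vec_def E_outside)

lemma A_E:
  assumes "i \<le> d" "l \<le> d"
  shows "mat_mul S (A l) (E i) = (\<lambda>x y. P i l * E i x y)"
proof (intro ext)
  fix x y
  show "mat_mul S (A l) (E i) x y = P i l * E i x y"
  proof (cases "y \<in> S")
    case True
    have "mat_vec S (A l) (\<lambda>x. E i x y) x = P i l * E i x y"
      using eigen[OF assms column_in_column_space[OF finite_S True]] by simp
    then show ?thesis
      by (simp add: mat_vec_def mat_mul_def)
  qed (simp add: mat_mul_def E_outside assms)
qed

lemma lincomb_E:
  assumes "j \<le> d"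
  shows "mat_mul S (\<lambda>x y. \<Sum>l\<le>d. c l * A l x y) (E j)
    = (\<lambda>x y. (\<Sum>l\<le>d. c l * P j l) * E j x y)"
  by (simp add: mat_mul_sum_left A_E assms sum_distrib_right mult.assoc)

text \<open>As a combination of relation matrices, \<open>E i\<close> acts on \<open>E j\<close> as
  a scalar \<open>k\<close>. Multiplying by \<open>A l\<close> from the left and bracketing in both
  ways gives \<open>P i l * k = P j l * k\<close>, and some \<open>l\<close> separates the two
  rows.\<close>

lemma E_orthogonal:
  assumes i: "i \<le> d" and j: "j \<le> d" and "i \<noteq> j"
  shows "mat_mul S (E i) (E j) = (\<lambda>x y. 0)"
proof -
  define k where "k = (\<Sum>l\<le>d. coeff i l * P j l)"
  have EE: "mat_mul S (E i) (E j) = (\<lambda>x y. k * E j x y)"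
    unfolding k_def by (subst E_expand[OF i]) (rule lincomb_E[OF j])
  obtain l where l: "l \<le> d" "P i l \<noteq> P j l"
    using rows_distinct assms by blast
  obtain x y where xy: "E j x y \<noteq> 0"
    using E_nonzero[OF j] by blast
  have "mat_mul S (mat_mul S (A l) (E i)) (E j) = (\<lambda>x y. P i l * (k * E j x y))"
    by (simp add: A_E i l mat_mul_scale_left EE)
  moreover have "mat_mul S (A l) (mat_mul S (E i) (E j)) = (\<lambda>x y. k * (P j l * E j x y))"
    by (simp add: EE mat_mul_scale_right A_E j l)
  ultimately have "(\<lambda>x y. P i l * (k * E j x y)) = (\<lambda>x y. k * (P j l * E j x y))"
    by (simp only: mat_mul_assoc)
  then have "P i l * (k * E j x y) = k * (P j l * E j x y)"
    by (rule fun_cong[OF fun_cong])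
  then have "k = 0"
    using l xy by simp
  then show ?thesis
    using EE by simp
qed

text \<open>The difference of the two sides is a combination of relation matrices that annihilates
  every \<open>E j\<close>. Its eigenvalues therefore all vanish, and nonsingularity makes its
  coefficients zero.\<close>

lemma A_decomp:
  assumes l: "l \<le> d"
  shows "A l x y = (\<Sum>i\<le>d. P i l * E i x y)"
proof -
  \<comment> \<open>The coordinates of \<open>A l - (\<Sum>i\<le>d. P i l * E i)\<close> with
    respect to the relation matrices.\<close>
  define c where "c m = of_bool (m = l) - (\<Sum>i\<le>d. P i l * coeff i m)" for m
  have diff: "A l x y - (\<Sum>i\<le>d. P i l * E i x y) = (\<Sum>m\<le>d. c m * A m x y)" for x y
  proof -
    have "E i x y = (\<Sum>m\<le>d. coeff i m * A m x y)" if "i \<le> d" for i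
      using fun_cong[OF fun_cong[OF E_expand[OF that]]] .
    then have "(\<Sum>i\<le>d. P i l * E i x y) = (\<Sum>i\<le>d. \<Sum>m\<le>d. P i l * coeff i m * A m x y)"
      by (simp add: sum_distrib_left mult.assoc)
    also have "\<dots> = (\<Sum>m\<le>d. \<Sum>i\<le>d. P i l * coeff i m * A m x y)"
      by (rule sum.swap)
    finally have "(\<Sum>i\<le>d. P i l * E i x y) = (\<Sum>m\<le>d. (\<Sum>i\<le>d. P i l * coeff i m) * A m x y)"
      by (simp add: sum_distrib_right)
    moreover have "A l x y = (\<Sum>m\<le>d. of_bool (m = l) * A m x y)"
      using l by (simp add: of_bool_def if_distrib[of "\<lambda>t. t * _"] cong: if_cong)
    ultimately show ?thesis
      unfolding c_def left_diff_distrib sum_subtractf by linarith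
  qed
  have "(\<Sum>m\<le>d. c m * P j m) = 0" if j: "j \<le> d" for j
  proof -
    have "mat_mul S (E i) (E j) = (\<lambda>x y. of_bool (i = j) * E j x y)" if "i \<le> d" for i
      using that j E_idem E_orthogonal by (cases "i = j") auto
    then have proj: "mat_mul S (\<lambda>x y. \<Sum>i\<le>d. P i l * E i x y) (E j) = (\<lambda>x y. P j l * E j x y)"
      using j by (simp add: mat_mul_sum_left of_bool_def if_distrib[of "\<lambda>t. t * _"]
          if_distrib[of "\<lambda>t. _ * t"] cong: if_cong)
    have "(\<lambda>x y. (\<Sum>m\<le>d. c m * P j m) * E j x y)
        = mat_mul S (\<lambda>x y. A l x y - (\<Sum>i\<le>d. P i l * E i x y)) (E j)"
      unfolding diff by (rule lincomb_E[OF j, symmetric])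
    also have "\<dots> = (\<lambda>x y. mat_mul S (A l) (E j) x y
        - mat_mul S (\<lambda>x y. \<Sum>i\<le>d. P i l * E i x y) (E j) x y)"
      by (simp add: mat_mul_def left_diff_distrib sum_subtractf)
    also have "\<dots> = (\<lambda>x y. 0)"
      by (simp add: proj A_E j l)
    finally have "(\<Sum>m\<le>d. c m * P j m) * E j x y = 0" for x y
      by meson
    then show ?thesis
      using E_nonzero[OF j] by (auto simp: fun_eq_iff)
  qed
  then have "c m = 0" if "m \<le> d" for m
    using nonsingular that by blast
  then show ?thesis
    using diff[of x y] by simp
qed

text \<open>Products of relation matrices thus reduce to entrywise products of columns of the
  eigenmatrix, so an identity between columns becomes an identity between matrices.\<close>

lemma A_mult:
  assumes "l \<le> d" "m \<le> d"
  shows "mat_mul S (A l) (A m) x y = (\<Sum>i\<le>d. P i l * P i m * E i x y)"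
proof -
  have "A m = (\<lambda>x y. \<Sum>i\<le>d. P i m * E i x y)"
    by (intro ext A_decomp assms)
  then have "mat_mul S (A l) (A m) = (\<lambda>x y. \<Sum>i\<le>d. P i m * mat_mul S (A l) (E i) x y)"
    by (simp add: mat_mul_sum_right)
  then show ?thesis
    using assms by (simp add: A_E mult_ac)
qed

text \<open>Comparing the trace of \<open>A l * E i\<close> computed from the eigenvalue and from the coefficients
  of \<open>E i\<close>.\<close>

lemma coeff_eq:
  assumes i: "i \<le> d" and l: "l \<le> d" and ne: "S \<noteq> {}"
    and diag: "R 0 = Id_on S"
    and disj: "\<And>m m'. \<lbrakk>m \<le> d; m' \<le> d; m \<noteq> m'\<rbrakk> \<Longrightarrow> R m \<inter> R m' = {}"
    and sym: "sym (R l)"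
    and valency: "\<And>x. x \<in> S \<Longrightarrow> (\<Sum>y\<in>S. A l x y) = k"
  shows "coeff i l * k = P i l * coeff i 0"
proof -
  \<comment> \<open>By disjointness only one summand of the expansion survives at a given
    pair.\<close>
  have E_on: "E i x y = coeff i m" if "m \<le> d" "(x, y) \<in> R m" for x y m
  proof -
    have "coeff i m' * A m' x y = (if m' = m then coeff i m else 0)" if "m' \<le> d" for m'
      using disj[of m' m] that \<open>m \<le> d\<close> \<open>(x, y) \<in> R m\<close> by (auto simp: adjacency_def)
    then show ?thesis
      using \<open>m \<le> d\<close> by (subst E_expand[OF i]) simp
  qed
  have "coeff i l * k * real (card S) = (\<Sum>x\<in>S. coeff i l * (\<Sum>y\<in>S. A l x y))"
    by (simp add: valency)
  also have "\<dots> = (\<Sum>x\<in>S. \<Sum>y\<in>S. A l x y * E i y x)"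
    unfolding sum_distrib_left
  proof (intro sum.cong refl)
    fix x y
    \<comment> \<open>Symmetry of \<open>R l\<close> is what allows the transposed entry
      \<open>E i y x\<close> to be read off at a pair \<open>(x, y)\<close> of
      \<open>R l\<close>.\<close>
    show "coeff i l * A l x y = A l x y * E i y x"
      using E_on[OF l, of y x] sym by (auto simp: adjacency_def dest: symD)
  qed
  also have "\<dots> = (\<Sum>x\<in>S. mat_mul S (A l) (E i) x x)"
    by (simp add: mat_mul_def)
  also have "\<dots> = (\<Sum>x\<in>S. P i l * coeff i 0)"
    by (rule sum.cong) (use E_on[of 0] diag in \<open>auto simp: A_E i l\<close>)
  finally show ?thesis
    using ne finite_S by simp
qed

end


section \<open>The eigenmatrix\<close>

lemma sum_atMost_4: "(\<Sum>i\<le>(4::nat). f i) = f 0 + f 1 + f 2 + f 3 + (f 4 :: real)"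
  by (simp add: eval_nat_numeral)

lemma all_le_4: "(\<forall>i\<le>(4::nat). p i) \<longleftrightarrow> p 0 \<and> p 1 \<and> p 2 \<and> p 3 \<and> p 4"
proof -
  have "i \<le> 4 \<longleftrightarrow> i = 0 \<or> i = 1 \<or> i = 2 \<or> i = 3 \<or> i = 4" for i :: nat
    by auto
  then show ?thesis
    by auto
qed

lemma power_pred:
  fixes q :: real
  assumes "n \<ge> 2"
  shows "q ^ (n - 1) = q * q ^ (n - 2)"
proof -
  have "n - 1 = Suc (n - 2)"
    using assms by simp
  then show ?thesis
    by simp
qed

text \<open>Naming \<open>q ^ (n - 2)\<close> turns all entries into polynomials in \<open>q\<close>
  and \<open>a\<close>, free of exponents that depend on \<open>n\<close>.\<close>

lemma eigenmatrix_rows: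
  fixes q :: real
  assumes n: "n \<ge> 2" and a: "a = q ^ (n - 2)"
  shows "eigenmatrix q n 0 0 = 1"
    "eigenmatrix q n 0 1 = (a - 1) * (q * a + 1)"
    "eigenmatrix q n 0 2 = a * (q - 2) * (q * a + 1)"
    "eigenmatrix q n 0 3 = (a - 1) * (q * a + 1)"
    "eigenmatrix q n 0 4 = 1"
    "eigenmatrix q n 1 0 = 1"
    "eigenmatrix q n 1 1 = q * a + 1"
    "eigenmatrix q n 1 2 = 0"
    "eigenmatrix q n 1 3 = - (q * a + 1)"
    "eigenmatrix q n 1 4 = - 1"
    "eigenmatrix q n 2 0 = 1"
    "eigenmatrix q n 2 1 = a - 1"
    "eigenmatrix q n 2 2 = - 2 * a"
    "eigenmatrix q n 2 3 = a - 1"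
    "eigenmatrix q n 2 4 = 1"
    "eigenmatrix q n 3 0 = 1"
    "eigenmatrix q n 3 1 = - (a - 1)"
    "eigenmatrix q n 3 2 = 0"
    "eigenmatrix q n 3 3 = a - 1"
    "eigenmatrix q n 3 4 = - 1"
    "eigenmatrix q n 4 0 = 1"
    "eigenmatrix q n 4 1 = - a * (q - 2) - 1"
    "eigenmatrix q n 4 2 = 2 * a * (q - 2)"
    "eigenmatrix q n 4 3 = - a * (q - 2) - 1"
    "eigenmatrix q n 4 4 = 1"
  using power_pred[OF n, of q] by (simp_all add: eigenmatrix_def a)

text \<open>Column 4 separates rows 0, 2, 4 from rows 1, 3 by sign; column 2 separates rows 0, 2, 4
  from each other, and column 1 separates row 1 from row 3.\<close>

lemma eigenmatrix_rows_distinct: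
  fixes q :: real
  assumes q: "q > 2" and n: "n \<ge> 3" and ij: "i \<le> 4" "j \<le> 4" "i \<noteq> j"
  shows "\<exists>l\<le>4. eigenmatrix q n i l \<noteq> eigenmatrix q n j l"
proof -
  define a where "a = q ^ (n - 2)"
  have a: "a > 1"
    unfolding a_def using q n by (intro one_less_power) auto
  note rows = eigenmatrix_rows[OF _ a_def]
  have pos: "a * (q - 2) > 0" "q * a > 2" "a > 0"
    using a q mult_strict_mono[of 2 q 1 a] by auto
  have neg: "- a < a * (q - 2)"
    using pos by linarith
  have h: "a * (q - 2) * (q * a + 1) > 2 * a * (q - 2)"
    using mult_strict_left_mono[of 2 "q * a + 1" "a * (q - 2)"] pos by (simp add: mult_ac)
  have sep: "eigenmatrix q n i 4 \<noteq> eigenmatrix q n j 4 \<or> eigenmatrix q n i 2 \<noteq> eigenmatrix q n j 2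
      \<or> eigenmatrix q n i 1 \<noteq> eigenmatrix q n j 1"
  proof -
    have "\<forall>i\<le>4. \<forall>j\<le>4. i \<noteq> j \<longrightarrow> eigenmatrix q n i 4 \<noteq> eigenmatrix q n j 4
        \<or> eigenmatrix q n i 2 \<noteq> eigenmatrix q n j 2 \<or> eigenmatrix q n i 1 \<noteq> eigenmatrix q n j 1"
      unfolding all_le_4 using n q a pos h neg by (simp add: rows[simplified])
    then show ?thesis
      using ij by blast
  qed
  have "(4::nat) \<le> 4" "(2::nat) \<le> 4" "(1::nat) \<le> 4"
    by auto
  with sep show ?thesis
    by blast
qed

text \<open>Elimination: rows 1 and 3 identify \<open>c 3\<close> with \<open>c 1\<close> and
  \<open>c 4\<close> with \<open>c 0\<close>, rows 2 and 4 then identify all coefficients, and row 0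
  leaves a positive multiple of \<open>c 1\<close>, namely by the sum of the valencies.\<close>

lemma eigenmatrix_nonsingular:
  fixes q :: real
  assumes q: "q > 2" and n: "n \<ge> 3"
    and ker: "\<And>j. j \<le> 4 \<Longrightarrow> (\<Sum>m\<le>4. c m * eigenmatrix q n j m) = 0" and m: "m \<le> 4"
  shows "c m = 0"
proof -
  define a where "a = q ^ (n - 2)"
  have a: "a > 1"
    unfolding a_def using q n by (intro one_less_power) auto
  have n2: "n \<ge> 2"
    using n by simp
  note rows = eigenmatrix_rows[OF n2 a_def]
  have e0: "c 0 + c 1 * ((a - 1) * (q * a + 1)) + c 2 * (a * (q - 2) * (q * a + 1))
      + c 3 * ((a - 1) * (q * a + 1)) + c 4 = 0"
    using ker[of 0] unfolding sum_atMost_4 rows by simp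
  have e1: "c 0 + c 1 * (q * a + 1) - c 3 * (q * a + 1) - c 4 = 0"
    using ker[of 1] unfolding sum_atMost_4 rows by (simp add: algebra_simps)
  have e2: "c 0 + c 1 * (a - 1) - c 2 * (2 * a) + c 3 * (a - 1) + c 4 = 0"
    using ker[of 2] unfolding sum_atMost_4 rows by simp
  have e3: "c 0 - c 1 * (a - 1) + c 3 * (a - 1) - c 4 = 0"
    using ker[of 3] unfolding sum_atMost_4 rows by (simp add: algebra_simps)
  have e4: "c 0 - c 1 * (a * (q - 2) + 1) + c 2 * (2 * a * (q - 2))
      - c 3 * (a * (q - 2) + 1) + c 4 = 0"
    using ker[of 4] unfolding sum_atMost_4 rows by (simp add: algebra_simps)
  have "(q * a + a) * (c 1 - c 3) = 0"
    using e1 e3 by (simp add: algebra_simps)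
  moreover have "q * a + a > 0"
    using a q by (simp add: add_pos_pos)
  ultimately have c13: "c 3 = c 1"
    by simp
  then have c04: "c 4 = c 0"
    using e3 by simp
  have "2 * (a * (q - 1)) * (c 1 - c 2) = 0"
    using e2 e4 unfolding c13 c04 by (simp add: algebra_simps)
  moreover have "2 * (a * (q - 1)) \<noteq> 0"
    using a q by simp
  ultimately have c12: "c 2 = c 1"
    by simp
  have c01: "c 0 = c 1"
    using e2 unfolding c13 c04 c12 by (simp add: algebra_simps)
  have "c 1 * (2 + 2 * ((a - 1) * (q * a + 1)) + a * (q - 2) * (q * a + 1)) = 0"
    using e0 unfolding c13 c04 c12 c01 by (simp add: algebra_simps)
  moreover have "2 + 2 * ((a - 1) * (q * a + 1)) + a * (q - 2) * (q * a + 1) > 0"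
    using a q by (intro add_pos_pos mult_pos_pos) auto
  ultimately have "c 1 = 0"
    by simp
  then have "\<forall>m\<le>4. c m = 0"
    unfolding all_le_4 using c01 c12 c13 c04 by simp
  then show ?thesis
    using m by blast
qed

lemma eigenmatrix_row_0_pos:
  fixes q :: real
  assumes q: "q > 2" and n: "n \<ge> 3" and l: "l \<le> 4"
  shows "eigenmatrix q n 0 l > 0"
proof -
  define a where "a = q ^ (n - 2)"
  have a: "a > 1"
    unfolding a_def using q n by (intro one_less_power) auto
  have n2: "n \<ge> 2"
    using n by simp
  have qa: "q * a > 0"
    using a q by simp
  have "\<forall>l\<le>4. eigenmatrix q n 0 l > 0"
    unfolding all_le_4 eigenmatrix_rows[OF n2 a_def] using a q qa by (simp add: add_pos_pos)
  then show ?thesis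
    using l by blast
qed

text \<open>This is the spectral form of the statement that the relation matrices add up to a
  multiple of \<open>E 0\<close>.\<close>

lemma sum_eigenmatrix_row:
  fixes q :: real
  assumes n: "n \<ge> 2" and i: "i \<le> 4" "i \<noteq> 0"
  shows "(\<Sum>l\<le>4. eigenmatrix q n i l) = 0"
proof -
  have "\<forall>i\<le>4. i \<noteq> 0 \<longrightarrow> (\<Sum>l\<le>4. eigenmatrix q n i l) = 0"
    unfolding all_le_4 sum_atMost_4 eigenmatrix_rows[OF n refl] by (simp add: algebra_simps)
  then show ?thesis
    using i by blast
qed

text \<open>The eigenvalue versions of \<open>A 4 * A 4 = A 0\<close> and
  \<open>A 3 * A 4 = A 1\<close>.\<close>

lemma eigenmatrix_col_4:
  fixes q :: real
  assumes n: "n \<ge> 2" and i: "i \<le> 4"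
  shows "eigenmatrix q n i 4 * eigenmatrix q n i 4 = eigenmatrix q n i 0"
    "eigenmatrix q n i 3 * eigenmatrix q n i 4 = eigenmatrix q n i 1"
proof -
  have "\<forall>i\<le>4. eigenmatrix q n i 4 * eigenmatrix q n i 4 = eigenmatrix q n i 0
      \<and> eigenmatrix q n i 3 * eigenmatrix q n i 4 = eigenmatrix q n i 1"
    unfolding all_le_4 eigenmatrix_rows[OF n refl] by simp
  then show "eigenmatrix q n i 4 * eigenmatrix q n i 4 = eigenmatrix q n i 0"
    "eigenmatrix q n i 3 * eigenmatrix q n i 4 = eigenmatrix q n i 1"
    using i by blast+
qed

text \<open>Up to a positive factor this sum is the Krein parameter \<open>q\<^sub>1\<^sub>1\<^sup>4\<close>.\<close>

lemma eigenmatrix_krein_zero: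
  fixes q :: real
  assumes q: "q > 2"
  shows "(\<Sum>l\<le>4. (eigenmatrix q 3 1 l)\<^sup>2 * eigenmatrix q 3 4 l / (eigenmatrix q 3 0 l)\<^sup>2) = 0"
proof -
  have n2: "(3::nat) \<ge> 2" and a: "q = q ^ (3 - 2)"
    by simp_all
  have pos: "q * q + 1 > 0" "q - 1 > 0"
    using q by (simp_all add: add_pos_pos)
  \<comment> \<open>For \<open>n = 3\<close> the entries of row 4 in columns 1 and 3 are negative
    squares, which cancel against the factor \<open>(q - 1)\<^sup>2\<close> from the valencies.
    These two columns contribute -1 each, columns 0 and 4 contribute 1 each, and column 2
    contributes 0.\<close>
  have sq: "- q * (q - 2) - 1 = - ((q - 1)\<^sup>2)"
    by (simp add: power2_eq_square algebra_simps)
  have "s\<^sup>2 * (- (t\<^sup>2)) / (t * s)\<^sup>2 = - 1" if "s > 0" "t > 0" for s t :: real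
    using that by (simp add: power_mult_distrib)
  from this[OF pos] show ?thesis
    unfolding sum_atMost_4 eigenmatrix_rows[OF n2 a] sq power2_minus by simp
qed


section \<open>The scheme on the points outside the hyperplane\<close>

locale quadric_scheme =
  fixes Q :: "'a::{field,finite} ^ 'd \<Rightarrow> 'a" and H :: "('a ^ 'd) set" and n :: nat
    and E :: "nat \<Rightarrow> ('a ^ 'd) set \<Rightarrow> ('a ^ 'd) set \<Rightarrow> real" and q :: real
  assumes q_eq: "q = real CARD('a)"
    and q_gt_2: "q > 2"
    and n_ge_3: "n \<ge> 3"
    and idempotents: "ordered_idempotents Q H n E"
    and Omega_nonempty: "Omega Q H \<noteq> {}"
begin

abbreviation "\<Omega> \<equiv> Omega Q H"
abbreviation "R \<equiv> scheme_rel Q H"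
abbreviation "P \<equiv> eigenmatrix q n"

lemma n_ge_2: "n \<ge> 2"
  using n_ge_3 by simp

lemma finite_Omega: "finite \<Omega>"
  by (rule finite_subset[OF subset_UNIV finite])

lemma E_minimal: "i \<le> 4 \<Longrightarrow> E i \<in> minimal_idempotents \<Omega> (bose_mesner 4 R)"
  using idempotents unfolding ordered_idempotents_def bij_betw_def by blast

sublocale spectral_scheme \<Omega> 4 R P E
proof
  show "finite \<Omega>"
    by (rule finite_Omega)
  show "R l \<subseteq> \<Omega> \<times> \<Omega>" for l
    by (auto simp: scheme_rel_def)
  show "E i \<in> bose_mesner 4 R" "E i \<noteq> (\<lambda>x y. 0)" "mat_mul \<Omega> (E i) (E i) = E i" if "i \<le> 4" for i
    using E_minimal[OF that] unfolding minimal_idempotents_def by blast+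
  show "mat_vec \<Omega> (adjacency (R l)) v = (\<lambda>x. P i l * v x)"
    if "i \<le> 4" "l \<le> 4" "v \<in> column_space \<Omega> (E i)" for i l v
    using idempotents that unfolding ordered_idempotents_def q_eq[symmetric] by blast
  show "\<exists>l\<le>4. P i l \<noteq> P j l" if "i \<le> 4" "j \<le> 4" "i \<noteq> j" for i j
    using eigenmatrix_rows_distinct[OF q_gt_2 n_ge_3 that] .
  show "c m = 0" if "\<And>j. j \<le> 4 \<Longrightarrow> (\<Sum>m\<le>4. c m * P j m) = 0" "m \<le> 4" for c m
    using eigenmatrix_nonsingular[OF q_gt_2 n_ge_3 that] .
qed

lemma E_0: "E 0 = (\<lambda>X Y. of_bool (X \<in> \<Omega> \<and> Y \<in> \<Omega>) / real (card \<Omega>))"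
  using idempotents unfolding ordered_idempotents_def by blast

lemma card_Omega_pos: "real (card \<Omega>) > 0"
  using Omega_nonempty finite_Omega by (simp add: card_gt_0_iff)

lemma column_space_E_0: "v \<in> column_space \<Omega> (E 0) \<Longrightarrow> \<exists>c. \<forall>x\<in>\<Omega>. v x = c"
  by (auto simp: column_space_def mat_vec_def E_0)

text \<open>\<open>E 0\<close> is averaging over \<Omega>, and it annihilates the other column
  spaces by orthogonality.\<close>

lemma sum_column_space:
  assumes i: "i \<le> 4" "i \<noteq> 0" and v: "v \<in> column_space \<Omega> (E i)"
  shows "sum v \<Omega> = 0"
proof -
  obtain u where u: "v = mat_vec \<Omega> (E i) u"
    using v unfolding column_space_def by blast
  have "mat_vec \<Omega> (E 0) v = mat_vec \<Omega> (\<lambda>x y. 0) u"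
    unfolding u using i by (simp add: E_orthogonal flip: mat_vec_mat_mul)
  then have "mat_vec \<Omega> (E 0) v = (\<lambda>x. 0)"
    by (simp add: mat_vec_def)
  moreover obtain x where "x \<in> \<Omega>"
    using Omega_nonempty by blast
  ultimately have "(\<Sum>y\<in>\<Omega>. v y / real (card \<Omega>)) = 0"
    by (auto simp: mat_vec_def E_0 dest!: fun_cong[of _ _ x])
  then show ?thesis
    using card_Omega_pos Omega_nonempty by (simp flip: sum_divide_distrib)
qed

lemma indicator_Omega_in: "indicator \<Omega> \<in> column_space \<Omega> (E 0)"
proof -
  have "mat_vec \<Omega> (E 0) (\<lambda>x. 1) = indicator \<Omega>"
    using card_Omega_pos by (auto simp: fun_eq_iff mat_vec_def E_0 indicator_def)
  then show ?thesis
    unfolding column_space_def by (metis rangeI)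
qed

text \<open>The constant vector spans the eigenspace of \<open>E 0\<close>, so its eigenvalue under
  \<open>A l\<close> is the row sum.\<close>

lemma valency:
  assumes "l \<le> 4" "x \<in> \<Omega>"
  shows "(\<Sum>y\<in>\<Omega>. A l x y) = P 0 l"
proof -
  have "mat_vec \<Omega> (A l) (indicator \<Omega>) x = P 0 l * indicator \<Omega> x"
    using eigen[OF _ assms(1) indicator_Omega_in] by simp
  then show ?thesis
    using assms by (simp add: mat_vec_def)
qed

section \<open>The relations partition the pairs of points\<close>

lemma R_0: "R 0 = Id_on \<Omega>"
  by (auto simp: scheme_rel_def)

lemma R_2_disjoint: "\<lbrakk>(x, y) \<in> R 2; l \<le> 4; l \<noteq> 2\<rbrakk> \<Longrightarrow> (x, y) \<notin> R l"
proof -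
  assume "(x, y) \<in> R 2" "l \<le> 4" "l \<noteq> 2"
  moreover have "\<forall>l\<le>4. l \<noteq> 2 \<longrightarrow> (x, y) \<in> R 2 \<longrightarrow> (x, y) \<notin> R l"
    unfolding all_le_4 by (simp add: scheme_rel_def)
  ultimately show ?thesis
    by blast
qed

text \<open>The sum of all relation matrices is a multiple of \<open>E 0\<close>, so every pair lies in the same number
  of relations. A pair in \<open>R 2\<close> lies in only one.\<close>

lemma sum_A:
  assumes "x \<in> \<Omega>" "y \<in> \<Omega>"
  shows "(\<Sum>l\<le>4. A l x y) = 1"
proof -
  define K where "K = (\<Sum>l\<le>4. P 0 l) / real (card \<Omega>)"
  have const: "(\<Sum>l\<le>4. A l x y) = K" if "x \<in> \<Omega>" "y \<in> \<Omega>" for x y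
  proof -
    have "(\<Sum>l\<le>4. A l x y) = (\<Sum>l\<le>4. \<Sum>i\<le>4. P i l * E i x y)"
      by (rule sum.cong) (auto intro: A_decomp)
    also have "\<dots> = (\<Sum>i\<le>4. \<Sum>l\<le>4. P i l * E i x y)"
      by (rule sum.swap)
    also have "\<dots> = (\<Sum>i\<le>4. (\<Sum>l\<le>4. P i l) * E i x y)"
      by (simp only: sum_distrib_right)
    also have "\<dots> = (\<Sum>i\<le>(4::nat). if i = 0 then (\<Sum>l\<le>4. P 0 l) * E 0 x y else 0)"
      by (rule sum.cong) (auto simp: sum_eigenmatrix_row[OF n_ge_2])
    finally show ?thesis
      using that by (simp add: K_def E_0)
  qed
  obtain z where z: "z \<in> \<Omega>"
    using Omega_nonempty by blast
  \<comment> \<open>Positive valency of \<open>R 2\<close> provides a pair at which the common value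
    \<open>K\<close> can be evaluated.\<close>
  have "(\<Sum>y\<in>\<Omega>. A 2 z y) \<noteq> 0"
    using valency[OF _ z, of 2] eigenmatrix_row_0_pos[OF q_gt_2 n_ge_3, of 2] by simp
  then obtain w where w: "w \<in> \<Omega>" "A 2 z w \<noteq> 0"
    by (meson sum.neutral)
  then have zw: "(z, w) \<in> R 2"
    by (auto simp: adjacency_def)
  have "(\<Sum>l\<le>4. A l z w) = (\<Sum>l\<le>(4::nat). if l = 2 then 1 else 0)"
    by (rule sum.cong) (use zw R_2_disjoint[OF zw] in \<open>auto simp: adjacency_def\<close>)
  then have "K = 1"
    using const[OF z w(1)] by simp
  then show ?thesis
    using const assms by simp
qed

lemma R_disjoint:
  assumes "l \<le> 4" "m \<le> 4" "l \<noteq> m"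
  shows "R l \<inter> R m = {}"
proof (rule ccontr)
  assume "R l \<inter> R m \<noteq> {}"
  then obtain x y where xy: "(x, y) \<in> R l" "(x, y) \<in> R m"
    by auto
  then have "x \<in> \<Omega>" "y \<in> \<Omega>"
    by (auto simp: scheme_rel_def)
  moreover have "(\<Sum>k\<in>{l, m}. A k x y) \<le> (\<Sum>k\<le>4. A k x y)"
    by (rule sum_mono2) (use assms in \<open>auto simp: adjacency_def\<close>)
  ultimately show False
    using xy assms(3) sum_A by (simp add: adjacency_def)
qed

lemma R_cover:
  assumes "x \<in> \<Omega>" "y \<in> \<Omega>"
  shows "\<exists>l\<le>4. (x, y) \<in> R l"
proof (rule ccontr)
  assume "\<not> ?thesis"
  then have "(\<Sum>l\<le>4. A l x y) = 0"
    by (simp add: adjacency_def)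
  then show False
    using sum_A[OF assms] by simp
qed

section \<open>The involution given by \<open>R 4\<close> and symmetry of the relations\<close>

lemma A_4_squared: "mat_mul \<Omega> (A 4) (A 4) = A 0"
proof (intro ext)
  fix x y
  have "mat_mul \<Omega> (A 4) (A 4) x y = (\<Sum>i\<le>4. P i 4 * P i 4 * E i x y)"
    by (rule A_mult) simp_all
  also have "\<dots> = (\<Sum>i\<le>4. P i 0 * E i x y)"
    by (rule sum.cong) (simp_all add: eigenmatrix_col_4[OF n_ge_2])
  also have "\<dots> = A 0 x y"
    by (rule A_decomp[symmetric]) simp
  finally show "mat_mul \<Omega> (A 4) (A 4) x y = A 0 x y" .
qed

lemma A_3_A_4: "mat_mul \<Omega> (A 3) (A 4) x y = A 1 x y" "mat_mul \<Omega> (A 4) (A 3) x y = A 1 x y"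
proof -
  have "mat_mul \<Omega> (A 3) (A 4) x y = (\<Sum>i\<le>4. P i 3 * P i 4 * E i x y)"
    by (rule A_mult) simp_all
  also have "\<dots> = (\<Sum>i\<le>4. P i 1 * E i x y)"
    by (rule sum.cong) (simp_all add: eigenmatrix_col_4[OF n_ge_2])
  also have "\<dots> = A 1 x y"
    by (rule A_decomp[symmetric]) simp
  finally show "mat_mul \<Omega> (A 3) (A 4) x y = A 1 x y" .
  moreover have "mat_mul \<Omega> (A 4) (A 3) x y = mat_mul \<Omega> (A 3) (A 4) x y"
    by (simp add: A_mult mult_ac)
  ultimately show "mat_mul \<Omega> (A 4) (A 3) x y = A 1 x y"
    by simp
qed

text \<open>A row of zeros and ones with sum \<open>P 0 4 = 1\<close> has exactly one nonzero entry;
  \<open>t\<close> plays the part of the image of \<open>x\<close> under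
  \<open>sigma\<close>.\<close>

lemma R_4_unique:
  assumes x: "x \<in> \<Omega>"
  obtains t where "t \<in> \<Omega>" "\<And>y. y \<in> \<Omega> \<Longrightarrow> A 4 x y = of_bool (y = t)"
proof -
  have "P 0 4 = 1"
    by (rule eigenmatrix_rows(5)[OF n_ge_2 refl])
  then have "(\<Sum>y\<in>\<Omega>. A 4 x y) = 1"
    using valency[OF _ x, of 4] by simp
  then have "real (card {y \<in> \<Omega>. (x, y) \<in> R 4}) = 1"
    by (simp add: adjacency_def of_bool_def sum.If_cases[OF finite_Omega] Collect_conj_eq Int_commute)
  then obtain t where t: "{y \<in> \<Omega>. (x, y) \<in> R 4} = {t}"
    by (auto simp: card_1_singleton_iff)
  show thesis
  proof (rule that[of t])
    show "t \<in> \<Omega>"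
      using t by blast
    show "A 4 x y = of_bool (y = t)" if "y \<in> \<Omega>" for y
      using t that by (auto simp: adjacency_def set_eq_iff)
  qed
qed

text \<open>The point \<open>t\<close> is chosen before \<open>f\<close>, so all components of a
  characteristic vector can be compared at the same partner of \<open>x\<close>.\<close>

lemma A_4_vec:
  assumes x: "x \<in> \<Omega>"
  obtains t where "t \<in> \<Omega>" "\<And>f. mat_vec \<Omega> (A 4) f x = f t"
proof -
  obtain t where t: "t \<in> \<Omega>" "\<And>y. y \<in> \<Omega> \<Longrightarrow> A 4 x y = of_bool (y = t)"
    using R_4_unique[OF x] by blast
  have "mat_vec \<Omega> (A 4) f x = f t" for f
  proof -
    have "mat_vec \<Omega> (A 4) f x = (\<Sum>y\<in>\<Omega>. if y = t then f t else 0)"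
      unfolding mat_vec_def by (rule sum.cong) (auto simp: t(2))
    then show ?thesis
      using t(1) finite_Omega by simp
  qed
  then show thesis
    using that t(1) by blast
qed

text \<open>If \<open>y\<close> is the partner of \<open>x\<close>, then \<open>A 4 y x\<close> is
  the diagonal entry at \<open>x\<close> of the square of \<open>A 4\<close>, which is the identity
  on \<Omega>.\<close>

lemma sym_R_4: "sym (R 4)"
proof (rule symI)
  fix x y assume xy: "(x, y) \<in> R 4"
  then have x: "x \<in> \<Omega>" and y: "y \<in> \<Omega>"
    by (auto simp: scheme_rel_def)
  obtain t where t: "t \<in> \<Omega>" "\<And>f. mat_vec \<Omega> (A 4) f x = f t"
    using A_4_vec[OF x] by blast
  have "A 4 x y = 1"
    using xy by (simp add: adjacency_def)
  have eq: "t = y"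
  proof -
    have "mat_vec \<Omega> (A 4) (\<lambda>z. of_bool (z = y)) x = A 4 x y"
      using y finite_Omega by (simp add: mat_vec_def of_bool_def if_distrib cong: if_cong)
    then show ?thesis
      using t(2) \<open>A 4 x y = 1\<close> by auto
  qed
  have "A 4 y x = mat_vec \<Omega> (A 4) (\<lambda>z. A 4 z x) x"
    using t(2) eq by simp
  also have "\<dots> = mat_mul \<Omega> (A 4) (A 4) x x"
    by (simp add: mat_vec_def mat_mul_def)
  also have "\<dots> = 1"
    using x unfolding A_4_squared by (simp add: adjacency_def R_0 Id_on_iff)
  finally show "(y, x) \<in> R 4"
    by (simp add: adjacency_def)
qed

text \<open>Collinear pairs lie in \<open>R 3\<close> or \<open>R 4\<close>, and both collinearity and \<open>R 4\<close> are symmetric.\<close>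

lemma R_3_iff:
  "(x, y) \<in> R 3 \<longleftrightarrow> x \<in> \<Omega> \<and> y \<in> \<Omega> \<and> collinear_on Q y x \<and> (x, y) \<notin> R 4"
proof
  assume xy: "(x, y) \<in> R 3"
  then show "x \<in> \<Omega> \<and> y \<in> \<Omega> \<and> collinear_on Q y x \<and> (x, y) \<notin> R 4"
    using R_disjoint[of 3 4] by (auto simp: scheme_rel_def)
next
  assume *: "x \<in> \<Omega> \<and> y \<in> \<Omega> \<and> collinear_on Q y x \<and> (x, y) \<notin> R 4"
  then have "\<exists>l\<le>4. (x, y) \<in> R l"
    using R_cover by blast
  then have "(x, y) \<in> R 0 \<or> (x, y) \<in> R 1 \<or> (x, y) \<in> R 2 \<or> (x, y) \<in> R 3 \<or> (x, y) \<in> R 4"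
    using all_le_4[of "\<lambda>l. (x, y) \<notin> R l"] by blast
  moreover have "(x, y) \<notin> R 0" "(x, y) \<notin> R 1" "(x, y) \<notin> R 2"
    using * by (auto simp: scheme_rel_def collinear_on_def)
  ultimately show "(x, y) \<in> R 3"
    using * by blast
qed

lemma sym_R_3: "sym (R 3)"
proof (rule symI)
  have "collinear_on Q x y = collinear_on Q y x" for x y
    by (auto simp: collinear_on_def Un_commute)
  then show "(y, x) \<in> R 3" if "(x, y) \<in> R 3" for x y
    using that sym_R_4 unfolding R_3_iff by (auto dest: symD)
qed

lemma A_symI: "sym (R l) \<Longrightarrow> A l x y = A l y x"
  by (auto simp: adjacency_def dest: symD)

text \<open>\<open>A 1\<close> is the product of the commuting symmetric matrices \<open>A 3\<close>
  and \<open>A 4\<close>.\<close>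

lemma sym_R_1: "sym (R 1)"
proof (rule symI)
  fix x y assume "(x, y) \<in> R 1"
  have "A 1 y x = mat_mul \<Omega> (A 4) (A 3) y x"
    by (simp add: A_3_A_4)
  also have "\<dots> = mat_mul \<Omega> (A 3) (A 4) x y"
    unfolding mat_mul_def
    by (rule sum.cong) (simp_all add: A_symI[OF sym_R_4, of y] A_symI[OF sym_R_3, of x])
  also have "\<dots> = A 1 x y"
    by (simp add: A_3_A_4)
  finally show "(y, x) \<in> R 1"
    using \<open>(x, y) \<in> R 1\<close> by (simp add: adjacency_def)
qed

lemma sym_R:
  assumes "l \<le> 4"
  shows "sym (R l)"
proof -
  have sym0: "sym (R 0)"
    by (auto simp: R_0 sym_def)
  have "sym (R 2)"
  proof (rule symI)
    fix x y assume xy: "(x, y) \<in> R 2"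
    then have "x \<in> \<Omega>" "y \<in> \<Omega>"
      by (auto simp: scheme_rel_def)
    then obtain l where l: "l \<le> 4" "(y, x) \<in> R l"
      using R_cover by blast
    \<comment> \<open>If the reversed pair lay in another relation, which is already known to be
      symmetric, then \<open>(x, y)\<close> would lie there too.\<close>
    show "(y, x) \<in> R 2"
    proof (cases "l = 2")
      case False
      then have "sym (R l)"
        using l all_le_4[of "\<lambda>l. l \<noteq> 2 \<longrightarrow> sym (R l)"] sym0 sym_R_1 sym_R_3 sym_R_4 by auto
      then show ?thesis
        using R_2_disjoint[OF xy l(1) False] l(2) by (auto dest: symD)
    qed (use l in simp)
  qed
  then have "\<forall>l\<le>4. sym (R l)"
    unfolding all_le_4 using sym0 sym_R_1 sym_R_3 sym_R_4 by blast
  then show ?thesis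
    using assms by blast
qed

section \<open>Entries of the idempotents and the Krein sum\<close>

lemma E_sym:
  assumes "i \<le> 4"
  shows "E i x y = E i y x"
proof -
  have "(\<Sum>l\<le>4. coeff i l * A l x y) = (\<Sum>l\<le>4. coeff i l * A l y x)"
    by (intro sum.cong refl arg_cong2[where f = "(*)"] A_symI sym_R) simp
  then show ?thesis
    unfolding E_expand[OF assms] .
qed

text \<open>The relation between dual eigenvalues and eigenvalues, normalised by the diagonal entry
  \<open>coeff i 0\<close> of \<open>E i\<close>.\<close>

lemma E_value:
  assumes i: "i \<le> 4" and l: "l \<le> 4" and xy: "(x, y) \<in> R l"
  shows "E i x y = coeff i 0 * (P i l / P 0 l)"
proof -
  have "(\<Sum>m\<le>4. coeff i m * A m x y) = (\<Sum>m\<le>4. if m = l then coeff i l else 0)"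
    by (rule sum.cong) (use R_disjoint[of _ l] l xy in \<open>auto simp: adjacency_def\<close>)
  then have "E i x y = coeff i l"
    using l by (subst E_expand[OF i]) simp
  moreover have "coeff i l * P 0 l = P i l * coeff i 0"
    by (rule coeff_eq) (use i l Omega_nonempty R_0 R_disjoint sym_R valency in auto)
  moreover have "P 0 l > 0"
    by (rule eigenmatrix_row_0_pos[OF q_gt_2 n_ge_3 l])
  ultimately show ?thesis
    by (simp add: field_simps)
qed

lemma sum_E_1_E_1_E_4:
  assumes n: "n = 3"
  shows "(\<Sum>x\<in>\<Omega>. \<Sum>y\<in>\<Omega>. E 1 x y * E 1 x y * E 4 x y) = 0"
proof -
  \<comment> \<open>The value of the triple product on \<open>R l\<close>. Each factor brings
    \<open>P 0 l\<close> into the denominator; summing over the \<open>P 0 l\<close> neighbours of a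
    point cancels one of the three.\<close>
  define g where "g l = (coeff 1 0)\<^sup>2 * coeff 4 0 * ((P 1 l)\<^sup>2 * P 4 l / P 0 l ^ 3)" for l
  have "E 1 x y * E 1 x y * E 4 x y = (\<Sum>l\<le>4. g l * A l x y)" if xy: "x \<in> \<Omega>" "y \<in> \<Omega>" for x y
  proof -
    obtain l where l: "l \<le> 4" "(x, y) \<in> R l"
      using R_cover[OF xy] by blast
    have "(\<Sum>m\<le>4. g m * A m x y) = (\<Sum>m\<le>4. if m = l then g l else 0)"
      by (rule sum.cong) (use R_disjoint[of _ l] l in \<open>auto simp: adjacency_def\<close>)
    then show ?thesis
      using l by (simp add: E_value[OF _ l] g_def power2_eq_square power3_eq_cube)
  qed
  then have "(\<Sum>x\<in>\<Omega>. \<Sum>y\<in>\<Omega>. E 1 x y * E 1 x y * E 4 x y)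
      = (\<Sum>x\<in>\<Omega>. \<Sum>y\<in>\<Omega>. \<Sum>l\<le>4. g l * A l x y)"
    by simp
  also have "\<dots> = (\<Sum>x\<in>\<Omega>. \<Sum>l\<le>4. \<Sum>y\<in>\<Omega>. g l * A l x y)"
    by (intro sum.cong refl sum.swap)
  also have "\<dots> = (\<Sum>x\<in>\<Omega>. \<Sum>l\<le>4. g l * P 0 l)"
    by (intro sum.cong refl) (simp add: valency flip: sum_distrib_left)
  also have "(\<Sum>l\<le>4. g l * P 0 l)
      = (coeff 1 0)\<^sup>2 * coeff 4 0 * (\<Sum>l\<le>4. (P 1 l)\<^sup>2 * P 4 l / (P 0 l)\<^sup>2)"
    unfolding sum_distrib_left
  proof (rule sum.cong[OF refl])
    fix l :: nat assume "l \<in> {..4}"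
    then have "P 0 l > 0"
      by (intro eigenmatrix_row_0_pos[OF q_gt_2 n_ge_3]) simp
    then show "g l * P 0 l = (coeff 1 0)\<^sup>2 * coeff 4 0 * ((P 1 l)\<^sup>2 * P 4 l / (P 0 l)\<^sup>2)"
      by (simp add: g_def power2_eq_square power3_eq_cube)
  qed
  also have "(\<Sum>l\<le>4. (P 1 l)\<^sup>2 * P 4 l / (P 0 l)\<^sup>2) = 0"
    unfolding n by (rule eigenmatrix_krein_zero[OF q_gt_2])
  finally show ?thesis
    by simp
qed

section \<open>Sizes of the designs\<close>

lemma sum_indicator_Omega:
  assumes "\<theta> \<subseteq> \<Omega>"
  shows "(\<Sum>x\<in>\<Omega>. indicator \<theta> x) = real (card \<theta>)"
proof -
  have "(\<Sum>x\<in>\<Omega>. indicator \<theta> x) = (\<Sum>x\<in>\<theta>. 1 :: real)"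
    by (rule sum.mono_neutral_cong_right) (use assms finite_Omega in \<open>auto simp: indicator_def\<close>)
  then show ?thesis
    by simp
qed

lemma design_24_half:
  assumes sub: "\<theta> \<subseteq> \<Omega>" and ne: "\<theta> \<noteq> {}" "\<theta> \<noteq> \<Omega>"
    and mem: "indicator \<theta> \<in> eigenspace_sum \<Omega> E {0, 1, 3}"
  shows "real (card \<theta>) = real (card \<Omega>) / 2"
proof -
  obtain v where chi: "indicator \<theta> = (\<lambda>x. \<Sum>i\<in>{0::nat, 1, 3}. v i x)"
    and v: "\<forall>i\<in>{0, 1, 3}. v i \<in> column_space \<Omega> (E i)"
    using mem unfolding eigenspace_sum_def by blast
  have chi_eq: "indicator \<theta> x = v 0 x + (v 1 x + v 3 x)" for x
    by (simp add: chi)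
  obtain c where c: "\<And>x. x \<in> \<Omega> \<Longrightarrow> v 0 x = c"
    using column_space_E_0 v by blast
  \<comment> \<open>Only the constant component contributes to the sum, so \<open>c\<close> is the
    density of \<theta> in \<Omega>.\<close>
  have "(\<Sum>x\<in>\<Omega>. indicator \<theta> x) = sum (v 0) \<Omega> + (sum (v 1) \<Omega> + sum (v 3) \<Omega>)"
    unfolding chi_eq by (simp add: sum.distrib)
  also have "\<dots> = c * real (card \<Omega>)"
    using v sum_column_space[of 1 "v 1"] sum_column_space[of 3 "v 3"] c by simp
  finally have card: "real (card \<theta>) = c * real (card \<Omega>)"
    using sum_indicator_Omega[OF sub] by simp
  have "card \<theta> > 0" "card \<theta> < card \<Omega>"
    using sub ne finite_Omega by (auto simp: card_gt_0_iff psubset_card_mono finite_subset)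
  then have "0 < real (card \<theta>) / real (card \<Omega>)" "real (card \<theta>) / real (card \<Omega>) < 1"
    by simp_all
  then have c_bounds: "0 < c" "c < 1"
    using card Omega_nonempty by simp_all
  obtain x where x: "x \<in> \<Omega>"
    using Omega_nonempty by blast
  obtain t where t: "t \<in> \<Omega>" "\<And>f. mat_vec \<Omega> (A 4) f x = f t"
    using A_4_vec[OF x] by blast
  have vt: "v i t = P i 4 * v i x" if "i \<in> {0, 1, 3}" for i
    using eigen[of i 4 "v i"] v that t(2)[of "v i"] by auto
  have P4: "P 1 4 = - 1" "P 3 4 = - 1"
    by (rule eigenmatrix_rows[OF n_ge_2 refl])+
  have "indicator \<theta> t = c - (v 1 x + v 3 x)"
    unfolding chi_eq using vt[of 1] vt[of 3] P4 c t(1) by simp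
  moreover have "indicator \<theta> x = c + (v 1 x + v 3 x)"
    unfolding chi_eq using c x by simp
  ultimately have "indicator \<theta> x + indicator \<theta> t = 2 * c"
    by simp
  then have "c = 1 / 2"
    \<comment> \<open>The left side is 0, 1 or 2; nontriviality of \<theta> excludes the extreme
      values.\<close>
    using c_bounds by (cases "t \<in> \<theta>"; cases "x \<in> \<theta>"; simp)
  then show ?thesis
    using card by simp
qed

lemma design_23_dichotomy:
  assumes n: "n = 3" and sub: "\<theta> \<subseteq> \<Omega>"
    and mem: "indicator \<theta> \<in> eigenspace_sum \<Omega> E {0, 1, 4}"
  shows "indicator \<theta> \<in> eigenspace_sum \<Omega> E {0, 4} \<or> real (card \<theta>) = real (card \<Omega>) / 2"
proof -
  obtain v where chi: "indicator \<theta> = (\<lambda>x. \<Sum>i\<in>{0::nat, 1, 4}. v i x)"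
    and v: "\<forall>i\<in>{0, 1, 4}. v i \<in> column_space \<Omega> (E i)"
    using mem unfolding eigenspace_sum_def by blast
  have chi_eq: "indicator \<theta> x = v 0 x + v 1 x + v 4 x" for x
    by (simp add: chi)
  obtain c where c: "\<And>x. x \<in> \<Omega> \<Longrightarrow> v 0 x = c"
    using column_space_E_0 v by blast
  have "(\<Sum>x\<in>\<Omega>. indicator \<theta> x) = sum (v 0) \<Omega> + sum (v 1) \<Omega> + sum (v 4) \<Omega>"
    unfolding chi_eq by (simp add: sum.distrib)
  also have "\<dots> = c * real (card \<Omega>)"
    using v sum_column_space[of 1 "v 1"] sum_column_space[of 4 "v 4"] c by simp
  finally have card: "real (card \<theta>) = c * real (card \<Omega>)"
    using sum_indicator_Omega[OF sub] by simp
  have P4: "P 1 4 = - 1" "P 4 4 = 1"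
    by (rule eigenmatrix_rows[OF n_ge_2 refl])+
  have prod: "v 1 x * v 1 x * v 4 x = (1 / 2 - c) * (v 1 x)\<^sup>2" if x: "x \<in> \<Omega>" for x
  proof -
    obtain t where t: "t \<in> \<Omega>" "\<And>f. mat_vec \<Omega> (A 4) f x = f t"
      using A_4_vec[OF x] by blast
    have vt: "v i t = P i 4 * v i x" if "i \<in> {0, 1, 4}" for i
      using eigen[of i 4 "v i"] v that t(2)[of "v i"] by auto
    have "indicator \<theta> t = c - v 1 x + v 4 x"
      unfolding chi_eq using vt[of 1] vt[of 4] P4 c t(1) by simp
    moreover have "indicator \<theta> x = c + v 1 x + v 4 x"
      unfolding chi_eq using c x by simp
    \<comment> \<open>If both or neither of \<open>x\<close> and \<open>t\<close> lie in \<theta>,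
      subtracting the two equations gives \<open>v 1 x = 0\<close>; otherwise adding them gives the
      value of \<open>v 4 x\<close>.\<close>
    ultimately have "v 1 x = 0 \<or> v 4 x = 1 / 2 - c"
      by (cases "t \<in> \<theta>"; cases "x \<in> \<theta>"; simp; linarith)
    then show ?thesis
      by (auto simp: power2_eq_square)
  qed
  have "(\<Sum>x\<in>\<Omega>. v 1 x * v 1 x * v 4 x) = 0"
    by (rule krein_vanishing[where E = "E 1" and F = "E 1" and G = "E 4"])
      (use finite_Omega E_idem E_sym sum_E_1_E_1_E_4[OF n] v in auto)
  \<comment> \<open>The vanishing triple sum, rewritten by \<open>prod\<close>, is a multiple of the
    squared norm of \<open>v 1\<close>.\<close>
  then have "(1 / 2 - c) * (\<Sum>x\<in>\<Omega>. (v 1 x)\<^sup>2) = 0"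
    by (simp add: prod[simplified] sum_distrib_left)
  then consider "c = 1 / 2" | "(\<Sum>x\<in>\<Omega>. (v 1 x)\<^sup>2) = 0"
    by auto
  then show ?thesis
  proof cases
    case 1
    then show ?thesis
      using card by simp
  next
    case 2
    then have "v 1 x = 0" if "x \<in> \<Omega>" for x
      using that finite_Omega by (simp add: sum_nonneg_eq_0_iff)
    \<comment> \<open>Membership in \<open>eigenspace_sum\<close> is an equality of functions on all
      arguments, so points outside \<Omega> count as well.\<close>
    moreover have "v 1 x = 0" if "x \<notin> \<Omega>" for x
      using column_space_outside[of 1 "v 1"] v that by simp
    ultimately have "v 1 x = 0" for x
      by blast
    then have "indicator \<theta> = (\<lambda>x. \<Sum>i\<in>{0::nat, 4}. v i x)"
      by (simp add: chi)
    then show ?thesis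
      using v unfolding eigenspace_sum_def by blast
  qed
qed

end

theorem theorem7p5:
  fixes Q :: "'a::{field,finite} ^ 'd \<Rightarrow> 'a"
    and H :: "('a ^ 'd) set"
    and n :: nat
    and E :: "nat \<Rightarrow> ('a ^ 'd) set \<Rightarrow> ('a ^ 'd) set \<Rightarrow> real"
    and \<theta> :: "('a ^ 'd) set set"
  assumes "CARD('a) > 2"
    and "n \<ge> 3"
    and "CARD('d) = 2 * n"
    and "elliptic_form Q"
    and "hyperplane H"
    and "nondegenerate_on Q H"
    and "ordered_idempotents Q H n E"
    and "\<theta> \<subseteq> Omega Q H"
    and "\<theta> \<noteq> {}"
    and "\<theta> \<noteq> Omega Q H"
  shows "(indicator \<theta> \<in> eigenspace_sum (Omega Q H) E {0, 1} \<or>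
          indicator \<theta> \<in> eigenspace_sum (Omega Q H) E {0, 3} \<or>
          indicator \<theta> \<in> eigenspace_sum (Omega Q H) E {0, 1, 3}
            \<longrightarrow> real (card \<theta>) = real (card (Omega Q H)) / 2) \<and>
         (n = 3 \<and> indicator \<theta> \<in> eigenspace_sum (Omega Q H) E {0, 1, 4}
            \<longrightarrow> indicator \<theta> \<in> eigenspace_sum (Omega Q H) E {0, 4} \<or>
                real (card \<theta>) = real (card (Omega Q H)) / 2)"
proof -
  \<comment> \<open>That \<Omega> is nonempty comes from its nonempty subset \<theta>.\<close>
  interpret quadric_scheme Q H n E "real CARD('a)"
    by unfold_locales (use assms in auto)
  have sub: "eigenspace_sum \<Omega> E {0, 1} \<subseteq> eigenspace_sum \<Omega> E {0, 1, 3}"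
    "eigenspace_sum \<Omega> E {0, 3} \<subseteq> eigenspace_sum \<Omega> E {0, 1, 3}"
    by (rule eigenspace_sum_mono; simp)+
  show ?thesis
    using design_24_half[OF assms(8-10)] design_23_dichotomy[OF _ assms(8)] sub by blast
qed

end
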